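(* Let $X \xrightarrow{f} Z \xleftarrow{g} Y$ be continuous maps, where $Z$ is a path-connected $H$-group with multiplication $\mu\colon Z\times Z\to Z$ and homotopy inverse $\nu\colon Z\to Z$. Let $\delta_{f,g}\colon X\times Y\to Z$ be the map $\delta_{f,g}(x,y)=\mu\big(f(x),\nu(g(y))\big)$. Then $$\mathrm{TC}_H(f,g)=\mathrm{cat}(\delta_{f,g}).$$
   Context: All maps are continuous, $I=[0,1]$, and $Z^I$ is the path space with the compact-open topology. An $H$-group is an $H$-space that is homotopy associative, with a homotopy unit $e$ (chosen as basepoint) and a homotopy inverse. For maps $f\colon X\to Z$, $g\colon Y\to Z$, a subset $A\subseteq X\times Y$ is $(f,g)$-sectional if there is a continuous map $\sigma\colon A\to Z^I$ with $\sigma(x,y)(0)=f(x)$ and $\sigma(x,y)(1)=g(y)$ for all $(x,y)\in A$. The homotopy bivariate topological complexity $\mathrm{TC}_H(f,g)$ is the least integer $k\ge 0$ such that $X\times Y$ can be covered by $k+1$ open $(f,g)$-sectional subsets, and $\infty$ if no such $k$ exists. The category $\mathrm{cat}(h)$ of a map $h\colon A\to B$ is the least integer $k\ge 0$ such that $A$ can be covered by $k+1$ open subsets on each of which the restriction of $h$ is null-homotopic ($\infty$ if there is none). *)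

theory Defs
  imports "HOL-Analysis.Analysis" "HOL-Library.Extended_Nat"
begin

text \<open>
  The set of continuous maps from \<open>X\<close> to \<open>Y\<close>. Since HOL functions are total, a map is
  represented by its unique extension that is \<open>undefined\<close> outside \<open>topspace X\<close>.
\<close>

definition mapping_set :: "'a topology \<Rightarrow> 'b topology \<Rightarrow> ('a \<Rightarrow> 'b) set" where
  "mapping_set X Y = {p \<in> extensional (topspace X). continuous_map X Y p}"

text \<open>
  Taking \<open>K = {}\<close> shows that the subbasic sets cover \<open>mapping_set X Y\<close>, so that this is
  the underlying set of the topology.
\<close>

definition compact_open_topology :: "'a topology \<Rightarrow> 'b topology \<Rightarrow> ('a \<Rightarrow> 'b) topology" where
  "compact_open_topology X Y =
     topology_generated_by
       {{p \<in> mapping_set X Y. p ` K \<subseteq> U} | K U. compactin X K \<and> openin Y U}"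

lemma topspace_compact_open_topology: "topspace (compact_open_topology X Y) = mapping_set X Y"
  unfolding compact_open_topology_def topology_generated_by_topspace
  by (auto intro!: exI[of _ "mapping_set X Y"] exI[of _ "{}"])

definition path_space :: "'a topology \<Rightarrow> (real \<Rightarrow> 'a) topology" where
  "path_space Z = compact_open_topology (top_of_set {0..1}) Z"

text \<open>
  The homotopies below are free: they are not required to preserve the basepoint \<open>e\<close>.
  Every H-group in the based sense is in particular one in this sense.
\<close>

definition H_space :: "'a topology \<Rightarrow> ('a \<times> 'a \<Rightarrow> 'a) \<Rightarrow> 'a \<Rightarrow> bool" where
  "H_space Z \<mu> e \<longleftrightarrow>
     e \<in> topspace Z \<and>
     continuous_map (prod_topology Z Z) Z \<mu> \<and>
     homotopic_with (\<lambda>_. True) Z Z (\<lambda>z. \<mu> (e, z)) id \<and>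
     homotopic_with (\<lambda>_. True) Z Z (\<lambda>z. \<mu> (z, e)) id"

definition H_group :: "'a topology \<Rightarrow> ('a \<times> 'a \<Rightarrow> 'a) \<Rightarrow> 'a \<Rightarrow> ('a \<Rightarrow> 'a) \<Rightarrow> bool" where
  "H_group Z \<mu> e \<nu> \<longleftrightarrow>
     H_space Z \<mu> e \<and>
     homotopic_with (\<lambda>_. True) (prod_topology Z (prod_topology Z Z)) Z
       (\<lambda>(x, y, z). \<mu> (\<mu> (x, y), z)) (\<lambda>(x, y, z). \<mu> (x, \<mu> (y, z))) \<and>
     continuous_map Z Z \<nu> \<and>
     homotopic_with (\<lambda>_. True) Z Z (\<lambda>z. \<mu> (z, \<nu> z)) (\<lambda>_. e) \<and>
     homotopic_with (\<lambda>_. True) Z Z (\<lambda>z. \<mu> (\<nu> z, z)) (\<lambda>_. e)"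

text \<open>
  The least \<open>k\<close> such that \<open>X\<close> is covered by \<open>k + 1\<close> open sets satisfying \<open>P\<close>;
  it is \<open>\<infinity>\<close> if there is none, because \<open>Inf {} = \<infinity>\<close> in \<^typ>\<open>enat\<close>.
\<close>

definition open_cover_number :: "'a topology \<Rightarrow> ('a set \<Rightarrow> bool) \<Rightarrow> enat" where
  "open_cover_number X P =
     Inf {enat k | k. \<exists>U :: nat \<Rightarrow> 'a set.
            (\<forall>i\<le>k. openin X (U i) \<and> P (U i)) \<and> (\<Union>i\<le>k. U i) = topspace X}"

definition sectional ::
  "'a topology \<Rightarrow> 'b topology \<Rightarrow> 'c topology \<Rightarrow> ('a \<Rightarrow> 'c) \<Rightarrow> ('b \<Rightarrow> 'c) \<Rightarrow> ('a \<times> 'b) set \<Rightarrow> bool"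
where
  "sectional X Y Z f g A \<longleftrightarrow>
     A \<subseteq> topspace X \<times> topspace Y \<and>
     (\<exists>\<sigma>. continuous_map (subtopology (prod_topology X Y) A) (path_space Z) \<sigma> \<and>
          (\<forall>(x, y)\<in>A. \<sigma> (x, y) 0 = f x \<and> \<sigma> (x, y) 1 = g y))"

definition TC_H ::
  "'a topology \<Rightarrow> 'b topology \<Rightarrow> 'c topology \<Rightarrow> ('a \<Rightarrow> 'c) \<Rightarrow> ('b \<Rightarrow> 'c) \<Rightarrow> enat" where
  "TC_H X Y Z f g = open_cover_number (prod_topology X Y) (sectional X Y Z f g)"

definition null_homotopic :: "'a topology \<Rightarrow> 'b topology \<Rightarrow> ('a \<Rightarrow> 'b) \<Rightarrow> bool" where
  "null_homotopic A B h \<longleftrightarrow> (\<exists>c. homotopic_with (\<lambda>_. True) A B h (\<lambda>_. c))"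

definition map_cat :: "'a topology \<Rightarrow> 'b topology \<Rightarrow> ('a \<Rightarrow> 'b) \<Rightarrow> enat" where
  "map_cat A B h = open_cover_number A (\<lambda>U. null_homotopic (subtopology A U) B h)"

definition homotopy_difference ::
  "('c \<times> 'c \<Rightarrow> 'c) \<Rightarrow> ('c \<Rightarrow> 'c) \<Rightarrow> ('a \<Rightarrow> 'c) \<Rightarrow> ('b \<Rightarrow> 'c) \<Rightarrow> 'a \<times> 'b \<Rightarrow> 'c" where
  "homotopy_difference \<mu> \<nu> f g = (\<lambda>(x, y). \<mu> (f x, \<nu> (g y)))"

end

theory Submission
  imports Defs
begin

text \<open>
  Both invariants count the members of open covers of the same space \<open>X \<times> Y\<close>, so it suffices
  that an open set \<open>A\<close> is \<open>(f, g)\<close>-sectional if and only if \<open>\<delta>\<^sub>f\<^sub>,\<^sub>g\<close> is null-homotopic on \<open>A\<close>.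
  Both properties are equivalent to the condition that \<open>(x, y) \<mapsto> f x\<close> and \<open>(x, y) \<mapsto> g y\<close> are
  homotopic on \<open>A\<close>.

  For sectional sets this is the exponential law for the unit interval: a map \<open>A \<rightarrow> Z\<^sup>I\<close> is the
  same as a map \<open>I \<times> A \<rightarrow> Z\<close>. Currying needs no hypothesis on the spaces (the tube lemma suffices,
  \<open>continuous_map_curry_compact_open\<close>); uncurrying uses that every point of the interval has
  a neighbourhood base of compact sets (\<open>continuous_map_uncurry_compact_open\<close>).

  For null-homotopy one computes in the group of homotopy classes \<open>[A, Z]\<close>
  (\<open>H_group_homotopic_iff_null_homotopic_difference\<close>): the classes of \<open>a\<close> and \<open>b\<close> agree if and only
  if \<open>a b\<^sup>-\<^sup>1\<close> is the unit. Path-connectedness of \<open>Z\<close> makes every constant map represent the unit.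
\<close>

section \<open>The exponential law for the compact-open topology\<close>

lemma continuous_map_curry_compact_open:
  assumes h: "continuous_map (prod_topology C A) Z h"
  shows "continuous_map A (compact_open_topology C Z) (\<lambda>a. \<lambda>t\<in>topspace C. h (t, a))"
    (is "continuous_map _ _ ?\<sigma>")
  unfolding compact_open_topology_def
proof (rule continuous_on_generated_topo)
  have \<sigma>: "?\<sigma> a \<in> mapping_set C Z" if "a \<in> topspace A" for a
  proof -
    have "continuous_map C (prod_topology C A) (\<lambda>t. (t, a))"
      using that by (intro continuous_map_pairedI) auto
    then have "continuous_map C Z (h \<circ> (\<lambda>t. (t, a)))"
      using h by (rule continuous_map_compose)
    then have "continuous_map C Z (?\<sigma> a)"
      by (rule continuous_map_eq) auto
    then show ?thesis
      by (auto simp: mapping_set_def)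
  qed
  show "?\<sigma> ` topspace A \<subseteq> \<Union>{{p \<in> mapping_set C Z. p ` K \<subseteq> U} | K U. compactin C K \<and> openin Z U}"
    using \<sigma> topspace_compact_open_topology[of C Z]
    unfolding compact_open_topology_def topology_generated_by_topspace by blast
  fix B
  assume "B \<in> {{p \<in> mapping_set C Z. p ` K \<subseteq> U} | K U. compactin C K \<and> openin Z U}"
  then obtain K U where K: "compactin C K" and U: "openin Z U"
    and B: "B = {p \<in> mapping_set C Z. p ` K \<subseteq> U}"
    by blast
  have KC: "K \<subseteq> topspace C"
    using K by (rule compactin_subset_topspace)
  let ?W = "{z \<in> topspace (prod_topology C A). h z \<in> U}"
  have W: "openin (prod_topology C A) ?W"
    using h U by (rule openin_continuous_map_preimage)
  show "openin A (?\<sigma> -` B \<inter> topspace A)"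
  proof (subst openin_subopen, intro ballI)
    fix a
    assume a: "a \<in> ?\<sigma> -` B \<inter> topspace A"
    then have aA: "a \<in> topspace A" and "?\<sigma> a ` K \<subseteq> U"
      by (simp_all add: B)
    then have "h (t, a) \<in> U" if "t \<in> K" for t
      using that KC by (metis (lifting) image_subset_iff restrict_apply' subsetD)
    then have "K \<times> {a} \<subseteq> ?W"
      using KC aA by auto
    then obtain T V where V: "openin A V" "K \<subseteq> T" "a \<in> V" "T \<times> V \<subseteq> ?W"
      using tube_lemma_left[OF W K aA] by blast
    have "?\<sigma> b \<in> B" if "b \<in> V" for b
    proof -
      have "b \<in> topspace A"
        using that V(1) openin_subset by blast
      moreover have "?\<sigma> b ` K \<subseteq> U"
        using V KC that by auto
      ultimately show ?thesis
        using \<sigma> B by blast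
    qed
    then show "\<exists>T. openin A T \<and> a \<in> T \<and> T \<subseteq> ?\<sigma> -` B \<inter> topspace A"
      using V openin_subset[OF V(1)] by blast
  qed
qed

lemma continuous_map_uncurry_compact_open:
  assumes \<sigma>: "continuous_map A (compact_open_topology C Z) \<sigma>"
    and C: "neighbourhood_base_of (compactin C) C"
  shows "continuous_map (prod_topology C A) Z (\<lambda>(t, a). \<sigma> a t)"
  unfolding continuous_map_def
proof (intro conjI allI impI)
  have map: "\<sigma> a \<in> mapping_set C Z" if "a \<in> topspace A" for a
    using continuous_map_image_subset_topspace[OF \<sigma>] that
    by (auto simp: topspace_compact_open_topology)
  then show "(\<lambda>(t, a). \<sigma> a t) \<in> topspace (prod_topology C A) \<rightarrow> topspace Z"
    by (auto simp: mapping_set_def continuous_map_def)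
  fix U
  assume U: "openin Z U"
  let ?P = "{z \<in> topspace (prod_topology C A). (case z of (t, a) \<Rightarrow> \<sigma> a t) \<in> U}"
  show "openin (prod_topology C A) ?P"
    unfolding openin_prod_topology_alt
  proof (intro allI impI)
    fix t a
    assume ta: "(t, a) \<in> ?P"
    then have a: "a \<in> topspace A" and t: "t \<in> {s \<in> topspace C. \<sigma> a s \<in> U}"
      by auto
    have "openin C {s \<in> topspace C. \<sigma> a s \<in> U}"
      using map[OF a] U by (auto simp: mapping_set_def intro: openin_continuous_map_preimage)
    with t obtain T K where T: "openin C T" "t \<in> T" "T \<subseteq> K" and K: "compactin C K"
      and KU: "K \<subseteq> {s \<in> topspace C. \<sigma> a s \<in> U}"
      using C unfolding neighbourhood_base_of by meson
    let ?B = "{p \<in> mapping_set C Z. p ` K \<subseteq> U}"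
    have "openin (compact_open_topology C Z) ?B"
      unfolding compact_open_topology_def
      using K U by (intro topology_generated_by_Basis) blast
    then have V: "openin A {b \<in> topspace A. \<sigma> b \<in> ?B}"
      using \<sigma> openin_continuous_map_preimage by blast
    moreover have "a \<in> {b \<in> topspace A. \<sigma> b \<in> ?B}"
      using a map[OF a] KU by auto
    moreover have "T \<times> {b \<in> topspace A. \<sigma> b \<in> ?B} \<subseteq> ?P"
      using T KU by auto
    ultimately show "\<exists>T V. openin C T \<and> openin A V \<and> t \<in> T \<and> a \<in> V \<and> T \<times> V \<subseteq> ?P"
      using T by blast
  qed
qed

lemma unit_interval_compact_neighbourhood_base:
  "neighbourhood_base_of (compactin (top_of_set {0..1::real})) (top_of_set {0..1})"
proof -
  have "compact_space (top_of_set {0..1::real})"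
    by (simp add: compact_space_subtopology)
  moreover have "Hausdorff_space (top_of_set {0..1::real})"
    by (simp add: Hausdorff_space_subtopology)
  ultimately show ?thesis
    using locally_compact_space_neighbourhood_base compact_imp_locally_compact_space by blast
qed

section \<open>Sectional sets and homotopies\<close>

lemma sectional_iff_homotopic:
  assumes A: "A \<subseteq> topspace X \<times> topspace Y"
  shows "sectional X Y Z f g A \<longleftrightarrow>
    homotopic_with (\<lambda>_. True) (subtopology (prod_topology X Y) A) Z (f \<circ> fst) (g \<circ> snd)"
    (is "_ \<longleftrightarrow> homotopic_with _ ?A _ _ _")
proof
  have top: "topspace ?A = A"
    using A by auto
  let ?I = "top_of_set {0..1::real}"
  {
    assume "sectional X Y Z f g A"
    then obtain \<sigma> where \<sigma>: "continuous_map ?A (path_space Z) \<sigma>"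
      and ends: "\<And>x y. (x, y) \<in> A \<Longrightarrow> \<sigma> (x, y) 0 = f x \<and> \<sigma> (x, y) 1 = g y"
      unfolding sectional_def by blast
    have "continuous_map (prod_topology ?I ?A) Z (\<lambda>(t, a). \<sigma> a t)"
      using \<sigma> unit_interval_compact_neighbourhood_base
      unfolding path_space_def by (rule continuous_map_uncurry_compact_open)
    then show "homotopic_with (\<lambda>_. True) ?A Z (f \<circ> fst) (g \<circ> snd)"
      using ends top
      by (subst homotopic_with) (auto intro!: exI[of _ "\<lambda>(t, a). \<sigma> a t"])
  next
    assume "homotopic_with (\<lambda>_. True) ?A Z (f \<circ> fst) (g \<circ> snd)"
    then obtain h where h: "continuous_map (prod_topology ?I ?A) Z h"
      and ends: "\<And>a. h (0, a) = f (fst a)" "\<And>a. h (1, a) = g (snd a)"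
      unfolding homotopic_with_def by auto
    have "continuous_map ?A (path_space Z) (\<lambda>a. \<lambda>t\<in>topspace ?I. h (t, a))"
      using h unfolding path_space_def by (rule continuous_map_curry_compact_open)
    then show "sectional X Y Z f g A"
      using A ends unfolding sectional_def
      by (intro conjI exI[of _ "\<lambda>a. \<lambda>t\<in>topspace ?I. h (t, a)"]) auto
  }
qed

section \<open>Homotopy classes of maps into an H-group\<close>

lemma homotopic_with_binary_operation:
  assumes a: "homotopic_with (\<lambda>_. True) W Z a a'"
    and b: "homotopic_with (\<lambda>_. True) W Z b b'"
    and m: "continuous_map (prod_topology Z Z) Z m"
  shows "homotopic_with (\<lambda>_. True) W Z (\<lambda>w. m (a w, b w)) (\<lambda>w. m (a' w, b' w))"
proof -
  have diag: "continuous_map W (prod_topology W W) (\<lambda>w. (w, w))"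
    by (intro continuous_map_pairedI) auto
  have "homotopic_with (\<lambda>_. True) (prod_topology W W) (prod_topology Z Z)
    (\<lambda>z. (a (fst z), b (snd z))) (\<lambda>z. (a' (fst z), b' (snd z)))"
    using a b by (rule homotopic_with_prod_topology) simp
  then have "homotopic_with (\<lambda>_. True) W (prod_topology Z Z)
      ((\<lambda>z. (a (fst z), b (snd z))) \<circ> (\<lambda>w. (w, w))) ((\<lambda>z. (a' (fst z), b' (snd z))) \<circ> (\<lambda>w. (w, w)))"
    using diag by (rule homotopic_with_compose_continuous_map_right) simp
  from homotopic_with_compose_continuous_map_left[OF this m, where q = "\<lambda>_. True"] show ?thesis
    by (simp add: o_def)
qed

lemma path_connected_space_null_homotopic_iff:
  assumes "path_connected_space Z" and e: "e \<in> topspace Z"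
  shows "null_homotopic W Z h \<longleftrightarrow> homotopic_with (\<lambda>_. True) W Z h (\<lambda>_. e)"
proof
  assume "null_homotopic W Z h"
  then obtain c where c: "homotopic_with (\<lambda>_. True) W Z h (\<lambda>_. c)"
    unfolding null_homotopic_def by blast
  \<comment> \<open>If \<open>W\<close> is empty, \<open>c\<close> need not be a point of \<open>Z\<close>.\<close>
  have "homotopic_with (\<lambda>_. True) W Z (\<lambda>_. c) (\<lambda>_. e)"
  proof (cases "W = trivial_topology")
    case False
    then have "c \<in> topspace Z"
      using homotopic_with_imp_continuous_maps[OF c] by auto
    then show ?thesis
      using assms by (simp add: homotopic_constant_maps path_connected_space_iff_path_component)
  qed (simp add: homotopic_constant_maps)
  with c show "homotopic_with (\<lambda>_. True) W Z h (\<lambda>_. e)"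
    by (rule homotopic_with_trans)
qed (auto simp: null_homotopic_def)

lemma H_group_homotopic_iff_null_homotopic_difference:
  assumes H: "H_group Z \<mu> e \<nu>" and pc: "path_connected_space Z"
    and a: "continuous_map W Z a" and b: "continuous_map W Z b"
  shows "homotopic_with (\<lambda>_. True) W Z a b \<longleftrightarrow> null_homotopic W Z (\<lambda>w. \<mu> (a w, \<nu> (b w)))"
    (is "?hom \<longleftrightarrow> ?null")
proof -
  let ?h = "homotopic_with (\<lambda>_. True) W Z"
  have e: "e \<in> topspace Z" and \<mu>: "continuous_map (prod_topology Z Z) Z \<mu>"
    and \<nu>: "continuous_map Z Z \<nu>"
    using H by (auto simp: H_group_def H_space_def)
  note [trans] = homotopic_with_trans
  note cong = homotopic_with_binary_operation[OF _ _ \<mu>]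
  have refl: "?h k k" if "continuous_map W Z k" for k
    using that by simp
  have \<nu>b: "continuous_map W Z (\<lambda>w. \<nu> (b w))"
    using continuous_map_compose[OF b \<nu>] by (simp add: o_def)
  have pull: "?h (\<lambda>w. k (c w)) (\<lambda>w. l (c w))"
    if "homotopic_with (\<lambda>_. True) Z Z k l" "continuous_map W Z c" for k l c
    using homotopic_with_compose_continuous_map_right[OF that, where q = "\<lambda>_. True"]
    by (simp add: o_def)
  have units: "homotopic_with (\<lambda>_. True) Z Z (\<lambda>z. \<mu> (e, z)) id"
      "homotopic_with (\<lambda>_. True) Z Z (\<lambda>z. \<mu> (z, e)) id"
    and inverses: "homotopic_with (\<lambda>_. True) Z Z (\<lambda>z. \<mu> (z, \<nu> z)) (\<lambda>_. e)"
      "homotopic_with (\<lambda>_. True) Z Z (\<lambda>z. \<mu> (\<nu> z, z)) (\<lambda>_. e)"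
    and associative: "homotopic_with (\<lambda>_. True) (prod_topology Z (prod_topology Z Z)) Z
      (\<lambda>(x, y, z). \<mu> (\<mu> (x, y), z)) (\<lambda>(x, y, z). \<mu> (x, \<mu> (y, z)))"
    using H by (auto simp: H_group_def H_space_def)
  have left_unit: "?h (\<lambda>w. \<mu> (e, c w)) c" and right_unit: "?h (\<lambda>w. \<mu> (c w, e)) c"
    if "continuous_map W Z c" for c
    using pull[OF units(1) that] pull[OF units(2) that] by simp_all
  note right_inverse = pull[OF inverses(1) b] and left_inverse = pull[OF inverses(2) b]
  have "continuous_map W (prod_topology Z (prod_topology Z Z)) (\<lambda>w. (a w, \<nu> (b w), b w))"
    using a b \<nu>b by (intro continuous_map_pairedI)
  then have assoc: "?h (\<lambda>w. \<mu> (\<mu> (a w, \<nu> (b w)), b w)) (\<lambda>w. \<mu> (a w, \<mu> (\<nu> (b w), b w)))"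
    using homotopic_with_compose_continuous_map_right[OF associative, where q = "\<lambda>_. True"]
    by (fastforce simp: o_def)
  have "?hom \<longleftrightarrow> ?h (\<lambda>w. \<mu> (a w, \<nu> (b w))) (\<lambda>_. e)"
  proof
    assume ?hom
    then have "?h (\<lambda>w. \<mu> (a w, \<nu> (b w))) (\<lambda>w. \<mu> (b w, \<nu> (b w)))"
      using refl[OF \<nu>b] by (rule cong)
    then show "?h (\<lambda>w. \<mu> (a w, \<nu> (b w))) (\<lambda>_. e)"
      using right_inverse by (rule homotopic_with_trans)
  next
    assume null: "?h (\<lambda>w. \<mu> (a w, \<nu> (b w))) (\<lambda>_. e)"
    \<comment> \<open>In \<open>[W, Z]\<close>: \<open>a = a e = a (b\<^sup>-\<^sup>1 b) = (a b\<^sup>-\<^sup>1) b = e b = b\<close>.\<close>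
    have "?h a (\<lambda>w. \<mu> (a w, e))"
      using right_unit[OF a] by (rule homotopic_with_symD)
    also have "?h \<dots> (\<lambda>w. \<mu> (a w, \<mu> (\<nu> (b w), b w)))"
      using refl[OF a] homotopic_with_symD[OF left_inverse] by (rule cong)
    also have "?h \<dots> (\<lambda>w. \<mu> (\<mu> (a w, \<nu> (b w)), b w))"
      using assoc by (rule homotopic_with_symD)
    also have "?h \<dots> (\<lambda>w. \<mu> (e, b w))"
      using null refl[OF b] by (rule cong)
    also have "?h \<dots> b"
      using b by (rule left_unit)
    finally show ?hom .
  qed
  then show ?thesis
    by (simp add: path_connected_space_null_homotopic_iff[OF pc e])
qed

section \<open>Homotopy bivariate complexity of maps into an H-group\<close>

lemma sectional_iff_null_homotopic_homotopy_difference: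
  assumes f: "continuous_map X Z f" and g: "continuous_map Y Z g"
    and H: "H_group Z \<mu> e \<nu>" and pc: "path_connected_space Z"
    and A: "A \<subseteq> topspace X \<times> topspace Y"
  shows "sectional X Y Z f g A \<longleftrightarrow>
    null_homotopic (subtopology (prod_topology X Y) A) Z (homotopy_difference \<mu> \<nu> f g)"
proof -
  let ?A = "subtopology (prod_topology X Y) A"
  have "continuous_map ?A Z (f \<circ> fst)" "continuous_map ?A Z (g \<circ> snd)"
    using f g by (auto intro: continuous_map_compose continuous_map_from_subtopology
        continuous_map_fst continuous_map_snd)
  from H_group_homotopic_iff_null_homotopic_difference[OF H pc this] show ?thesis
    by (simp add: sectional_iff_homotopic[OF A] homotopy_difference_def case_prod_beta')
qed

theorem theorem8p9:
  fixes X :: "'a topology" and Y :: "'b topology" and Z :: "'c topology"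
    and f :: "'a \<Rightarrow> 'c" and g :: "'b \<Rightarrow> 'c"
    and \<mu> :: "'c \<times> 'c \<Rightarrow> 'c" and \<nu> :: "'c \<Rightarrow> 'c" and e :: 'c
  assumes "continuous_map X Z f" and "continuous_map Y Z g"
    and "H_group Z \<mu> e \<nu>" and "path_connected_space Z"
  shows "TC_H X Y Z f g = map_cat (prod_topology X Y) Z (homotopy_difference \<mu> \<nu> f g)"
proof -
  have "openin (prod_topology X Y) A \<and> sectional X Y Z f g A \<longleftrightarrow>
    openin (prod_topology X Y) A \<and>
    null_homotopic (subtopology (prod_topology X Y) A) Z (homotopy_difference \<mu> \<nu> f g)" for A
    using sectional_iff_null_homotopic_homotopy_difference[OF assms, of A]
      openin_subset[of "prod_topology X Y" A] by auto
  then show ?thesis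
    unfolding TC_H_def map_cat_def open_cover_number_def by simp
qed

end
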